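(* As an $\mathbb{N}$-semimodule (with scalar multiplication $n\times(p_i)_i=(np_i)_i$), $\mathbf{P}$ has a unique minimal generating set, namely $G=\{\mathbf{p}\in\mathbf{P} : p_0=1\}$, the set of profiles whose first term is $1$; this set $G$ is countably infinite and linearly dependent over $\mathbb{N}$, i.e. there exist finitely many $\mathbf{p}_1,\ldots,\mathbf{p}_m\in G$ and $a_i,b_i\in\mathbb{N}$ with $\sum_i a_i\mathbf{p}_i=\sum_i b_i\mathbf{p}_i$ but $a_i\ne b_i$ for some $i$.
   Context: A profile is a sequence $\mathbf{p}=(p_i)_{i\in\mathbb{N}}$ of natural numbers for which there exists $h\ge -1$ with $p_i\ge 1$ for $0\le i\le h$ and $p_i=0$ for $i>h$ (the null sequence $(0)$ is a profile). $\mathbf{P}$ is the set of profiles, with elementwise sum. A generating set of $\mathbf{P}$ as an $\mathbb{N}$-semimodule is a set $S\subseteq\mathbf{P}$ such that every profile is a finite $\mathbb{N}$-linear combination of elements of $S$; it is minimal if no proper subset is a generating set. *)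

theory Defs
  imports Complex_Main "HOL-Library.Function_Algebras" "HOL-Library.Countable_Set"
begin

text \<open>
  Sequences of naturals are functions \<open>nat \<Rightarrow> nat\<close>; \<open>0\<close>, \<open>+\<close> and \<open>\<Sum>\<close> on them are the pointwise
  operations of \<open>Function_Algebras\<close>.
\<close>

text \<open>The bound \<open>h\<close> is an integer: \<open>h = -1\<close> gives the null sequence.\<close>

definition is_profile :: "(nat \<Rightarrow> nat) \<Rightarrow> bool" where
  "is_profile p \<longleftrightarrow>
     (\<exists>h::int. h \<ge> -1 \<and> (\<forall>i. int i \<le> h \<longrightarrow> p i \<ge> 1) \<and> (\<forall>i. int i > h \<longrightarrow> p i = 0))"

definition profiles :: "(nat \<Rightarrow> nat) set" where
  "profiles = {p. is_profile p}"

definition nat_scale :: "nat \<Rightarrow> (nat \<Rightarrow> nat) \<Rightarrow> (nat \<Rightarrow> nat)" (infixr "\<cdot>" 75) where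
  "n \<cdot> p = (\<lambda>i. n * p i)"

definition nat_span :: "(nat \<Rightarrow> nat) set \<Rightarrow> (nat \<Rightarrow> nat) set" where
  "nat_span S = {v. \<exists>F c. finite F \<and> F \<subseteq> S \<and> v = (\<Sum>q\<in>F. c q \<cdot> q)}"

definition generating_set :: "(nat \<Rightarrow> nat) set \<Rightarrow> bool" where
  "generating_set S \<longleftrightarrow> S \<subseteq> profiles \<and> (\<forall>p\<in>profiles. p \<in> nat_span S)"

definition minimal_generating_set :: "(nat \<Rightarrow> nat) set \<Rightarrow> bool" where
  "minimal_generating_set S \<longleftrightarrow> generating_set S \<and> (\<forall>T. T \<subset> S \<longrightarrow> \<not> generating_set T)"

text \<open>
  There is no subtraction over \<open>nat\<close>, so dependence compares two combinations of the same vectors.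
  Taking these from a finite set makes them pairwise distinct; a family with repetitions would be
  trivially dependent.
\<close>

definition nat_linearly_dependent :: "(nat \<Rightarrow> nat) set \<Rightarrow> bool" where
  "nat_linearly_dependent S \<longleftrightarrow>
     (\<exists>F a b. finite F \<and> F \<subseteq> S \<and> (\<Sum>q\<in>F. a q \<cdot> q) = (\<Sum>q\<in>F. b q \<cdot> q) \<and> (\<exists>q\<in>F. a q \<noteq> b q))"

definition profiles_starting_with_one :: "(nat \<Rightarrow> nat) set" where
  "profiles_starting_with_one = {p \<in> profiles. p 0 = 1}"

text \<open>Profiles form an \<open>\<nat>\<close>-semimodule under the pointwise operations.\<close>

lemma nat_scale_laws:
  "n \<cdot> (p + q) = n \<cdot> p + n \<cdot> q"
  "(m + n) \<cdot> p = m \<cdot> p + n \<cdot> p"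
  "(m * n) \<cdot> p = m \<cdot> (n \<cdot> p)"
  "1 \<cdot> p = p"
  "0 \<cdot> p = 0"
  "n \<cdot> 0 = 0"
  by (simp_all add: nat_scale_def fun_eq_iff algebra_simps)

lemma zero_in_profiles: "0 \<in> profiles"
  unfolding profiles_def is_profile_def by (auto intro: exI[of _ "-1"])

lemma add_in_profiles:
  assumes "p \<in> profiles" "q \<in> profiles"
  shows "p + q \<in> profiles"
proof -
  obtain h where h: "h \<ge> -1" "\<And>i. int i \<le> h \<Longrightarrow> p i \<ge> 1" "\<And>i. int i > h \<Longrightarrow> p i = 0"
    using assms(1) unfolding profiles_def is_profile_def by blast
  obtain k where k: "k \<ge> -1" "\<And>i. int i \<le> k \<Longrightarrow> q i \<ge> 1" "\<And>i. int i > k \<Longrightarrow> q i = 0"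
    using assms(2) unfolding profiles_def is_profile_def by blast
  have "(p + q) i \<ge> 1" if "int i \<le> max h k" for i
    using that h(2)[of i] k(2)[of i] by (cases "int i \<le> h"; cases "int i \<le> k") auto
  moreover have "(p + q) i = 0" if "int i > max h k" for i
    using that h(3)[of i] k(3)[of i] by simp
  moreover have "max h k \<ge> -1" using h(1) by simp
  ultimately show ?thesis
    unfolding profiles_def is_profile_def by blast
qed

lemma nat_scale_in_profiles:
  assumes "p \<in> profiles"
  shows "n \<cdot> p \<in> profiles"
proof (induction n)
  case 0
  have "0 \<cdot> p = 0" by (simp add: nat_scale_def fun_eq_iff)
  then show ?case using zero_in_profiles by metis
next
  case (Suc n)
  have "Suc n \<cdot> p = p + n \<cdot> p" by (auto simp: nat_scale_def)
  then show ?case using add_in_profiles[OF assms Suc] by metis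
qed

end

theory Submission
  imports Defs
begin

text \<open>
  Lowering the first term of a nonzero profile to \<open>1\<close> leaves a profile, and the difference is a
  multiple of \<open>(1, 0, 0, \<dots>)\<close>; so the profiles with first term \<open>1\<close> generate. Conversely, the first
  term of a nonzero profile is positive, so a combination with first term \<open>1\<close> has a single nonzero
  summand, with coefficient \<open>1\<close>: every generating set contains all these profiles.
  The dependence is \<open>(1, 0) + (1, 2) = 2 (1, 1)\<close>.
\<close>

text \<open>Trades the integer bound \<open>h\<close> for the natural number
  \<open>n = h + 1\<close>, the length of the support; \<open>n = 0\<close> is the null
  sequence.\<close>

lemma profiles_iff: "p \<in> profiles \<longleftrightarrow> (\<exists>n. \<forall>i. 0 < p i \<longleftrightarrow> i < n)"
proof
  assume "p \<in> profiles"
  then obtain h where h: "h \<ge> -1" "\<And>i. int i \<le> h \<Longrightarrow> p i \<ge> 1" "\<And>i. int i > h \<Longrightarrow> p i = 0"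
    unfolding profiles_def is_profile_def by blast
  have "0 < p i \<longleftrightarrow> i < nat (h + 1)" for i
    using h(2)[of i] h(3)[of i] by (cases "int i \<le> h") auto
  then show "\<exists>n. \<forall>i. 0 < p i \<longleftrightarrow> i < n" by blast
next
  assume "\<exists>n. \<forall>i. 0 < p i \<longleftrightarrow> i < n"
  then obtain n where n: "\<And>i. 0 < p i \<longleftrightarrow> i < n" by blast
  have "p i \<ge> 1" if "int i \<le> int n - 1" for i
    using n[of i] that by simp
  moreover have "p i = 0" if "int i > int n - 1" for i
    using n[of i] that by simp
  moreover have "int n - 1 \<ge> -1" by simp
  ultimately show "p \<in> profiles"
    unfolding profiles_def is_profile_def by blast
qed

lemma sum_nat_scale_apply: "(\<Sum>q\<in>F. c q \<cdot> q) i = (\<Sum>q\<in>F. c q * q i)"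
  by (induction F rule: infinite_finite_induct) (auto simp: nat_scale_def)

lemma profile_eq_zero:
  assumes "p \<in> profiles" "p 0 = 0"
  shows "p = 0"
proof
  fix i
  obtain n where n: "\<And>i. 0 < p i \<longleftrightarrow> i < n"
    using assms(1) by (auto simp: profiles_iff)
  show "p i = 0 i" using n[of 0] n[of i] assms(2) by simp
qed

text \<open>A nonzero profile already has index 0 in its support, so another positive value there
  leaves the support unchanged.\<close>

lemma profile_upd_zero:
  assumes "p \<in> profiles" "p \<noteq> 0" "k > 0"
  shows "p(0 := k) \<in> profiles"
proof -
  obtain n where n: "\<And>i. 0 < p i \<longleftrightarrow> i < n"
    using assms(1) by (auto simp: profiles_iff)
  have "p 0 > 0" using profile_eq_zero assms by blast
  then show ?thesis using n assms(3)
    by (auto simp: profiles_iff intro!: exI[of _ n])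
qed

lemma upd_zero_one_in_profiles: "0(0 := 1) \<in> profiles"
  by (auto simp: profiles_iff intro!: exI[of _ 1])

lemma generating_set_starting_with_one: "generating_set profiles_starting_with_one"
  unfolding generating_set_def
proof (intro conjI ballI)
  show "profiles_starting_with_one \<subseteq> profiles"
    by (auto simp: profiles_starting_with_one_def)
next
  let ?e = "(0 :: nat \<Rightarrow> nat)(0 := 1)"
  fix p assume p: "p \<in> profiles"
  have e: "?e \<in> profiles_starting_with_one"
    using upd_zero_one_in_profiles by (simp add: profiles_starting_with_one_def)
  show "p \<in> nat_span profiles_starting_with_one"
  proof (cases "p = 0")
    case True
    then show ?thesis unfolding nat_span_def
      by (auto intro!: exI[of _ "{}"])
  next
    case False
    let ?q = "p(0 := 1)"
    have q: "?q \<in> profiles_starting_with_one"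
      using profile_upd_zero[OF p False] by (simp add: profiles_starting_with_one_def)
    have p0: "p 0 > 0" using profile_eq_zero p False by blast
    show ?thesis
    \<comment> \<open>If \<open>?q = ?e\<close>, the set \<open>{?q, ?e}\<close> collapses to one
      element, which must carry the whole coefficient \<open>p 0\<close>.\<close>
    proof (cases "?q = ?e")
      case True
      have "p = (\<Sum>q\<in>{?e}. p 0 \<cdot> q)"
      proof
        fix i
        show "p i = (\<Sum>q\<in>{?e}. p 0 \<cdot> q) i"
          using fun_cong[OF True, of i] by (cases "i = 0") (auto simp: nat_scale_def)
      qed
      then show ?thesis unfolding nat_span_def using e
        by (intro CollectI exI[of _ "{?e}"] exI[of _ "\<lambda>_. p 0"]) auto
    next
      case False
      \<comment> \<open>At index 0, \<open>?q\<close> contributes 1 and \<open>?e\<close> the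
        remaining \<open>p 0 - 1\<close>, a true difference since \<open>p 0 > 0\<close>; elsewhere
        \<open>?e\<close> vanishes.\<close>
      define c where "c q = (if q = ?e then p 0 - 1 else 1)" for q
      have "p = (\<Sum>q\<in>{?q, ?e}. c q \<cdot> q)"
      proof
        fix i
        show "p i = (\<Sum>q\<in>{?q, ?e}. c q \<cdot> q) i"
          using False p0 by (cases "i = 0") (simp_all add: c_def nat_scale_def)
      qed
      then show ?thesis unfolding nat_span_def using e q
        by (intro CollectI exI[of _ "{?q, ?e}"] exI[of _ c]) auto
    qed
  qed
qed

text \<open>Makes \<open>profiles_starting_with_one\<close> the least generating set, whence both
  its minimality and its uniqueness.\<close>

lemma generating_set_contains_starting_with_one:
  assumes "generating_set S"
  shows "profiles_starting_with_one \<subseteq> S"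
proof
  fix g assume g: "g \<in> profiles_starting_with_one"
  then have "g \<in> nat_span S"
    using assms by (auto simp: generating_set_def profiles_starting_with_one_def)
  then obtain F c where F: "finite F" "F \<subseteq> S" and g_eq: "g = (\<Sum>q\<in>F. c q \<cdot> q)"
    unfolding nat_span_def by blast
  have "(\<Sum>q\<in>F. c q * q 0) = 1"
    using g g_eq sum_nat_scale_apply[of c F 0] by (simp add: profiles_starting_with_one_def)
  then obtain r where r: "r \<in> F" "c r * r 0 = 1" "\<And>q. q \<in> F \<Longrightarrow> q \<noteq> r \<Longrightarrow> c q * q 0 = 0"
    using sum_eq_1_iff[OF F(1), of "\<lambda>q. c q * q 0"] by auto
  \<comment> \<open>Vanishing at index 0 kills the whole summand: either its coefficient is 0, or
    \<open>q 0 = 0\<close> and the profile \<open>q\<close> is null.\<close>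
  have "c q \<cdot> q = 0" if "q \<in> F" "q \<noteq> r" for q
  proof (cases "c q = 0")
    case True
    then show ?thesis by (simp add: nat_scale_laws)
  next
    case False
    then have "q = 0"
      using r(3)[OF that] profile_eq_zero[of q] that(1) F(2) assms
      by (auto simp: generating_set_def)
    then show ?thesis by (simp add: nat_scale_laws)
  qed
  then have "g = c r \<cdot> r"
    using g_eq sum.remove[OF F(1) r(1), of "\<lambda>q. c q \<cdot> q"] by simp
  moreover have "c r = 1" using r(2) by simp
  ultimately show "g \<in> S" using r(1) F(2) nat_scale_laws(4) by auto
qed

text \<open>A profile is the finite list of its positive terms padded with zeros, and there are
  countably many lists of naturals.\<close>

lemma countable_profiles: "countable profiles"
proof -
  let ?f = "\<lambda>xs i. if i < length xs then xs ! i else (0::nat)"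
  have "p \<in> range ?f" if p: "p \<in> profiles" for p
  proof -
    obtain n where n: "\<And>i. 0 < p i \<longleftrightarrow> i < n"
      using p by (auto simp: profiles_iff)
    have "p = ?f (map p [0..<n])"
    proof
      fix i
      show "p i = ?f (map p [0..<n]) i" using n[of i] by auto
    qed
    then show ?thesis by blast
  qed
  then have "profiles \<subseteq> range ?f" by blast
  then show ?thesis by (rule countable_subset) simp
qed

text \<open>The family (1, k, 0, ...) serves twice: it is infinite, and its members for k = 0, 1, 2
  satisfy a linear relation.\<close>

lemma upd_one_starting_with_one: "(0(0 := 1))(1 := k) \<in> profiles_starting_with_one"
proof -
  have "(0 < ((0(0 := 1))(1 := k)) i) = (i < (if k = 0 then 1 else 2))" for i :: nat
    by auto
  then show ?thesis unfolding profiles_starting_with_one_def profiles_iff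
    by (intro CollectI conjI exI[of _ "if k = 0 then 1 else 2"] allI) simp_all
qed

lemma inj_upd_one: "inj (\<lambda>k::nat. (0(0 := 1))(1 :: nat := k))"
  by (rule injI) (metis fun_upd_same)

lemma infinite_starting_with_one: "infinite profiles_starting_with_one"
proof
  assume "finite profiles_starting_with_one"
  then have "finite (range (\<lambda>k::nat. (0(0 := 1))(1 :: nat := k)))"
    by (rule finite_subset[rotated]) (use upd_one_starting_with_one in blast)
  then show False using finite_imageD inj_upd_one by blast
qed

lemma dependent_starting_with_one: "nat_linearly_dependent profiles_starting_with_one"
proof -
  define u :: "nat \<Rightarrow> nat \<Rightarrow> nat" where "u k = (0(0 := 1))(1 := k)" for k
  define a b :: "(nat \<Rightarrow> nat) \<Rightarrow> nat"
    where "a q = (if q = u 1 then 0 else 1)" and "b q = (if q = u 1 then 2 else 0)" for q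
  have inj: "u j = u k \<longleftrightarrow> j = k" for j k
    unfolding u_def by (rule inj_eq[OF inj_upd_one])
  have "(\<Sum>q\<in>{u 0, u 1, u 2}. a q \<cdot> q) = (\<Sum>q\<in>{u 0, u 1, u 2}. b q \<cdot> q)"
  proof
    fix i
    show "(\<Sum>q\<in>{u 0, u 1, u 2}. a q \<cdot> q) i = (\<Sum>q\<in>{u 0, u 1, u 2}. b q \<cdot> q) i"
      unfolding sum_nat_scale_apply
      \<comment> \<open>\<open>u\<close> stays folded at first, so that \<open>inj\<close> separates
        the three summands and decides the tests in \<open>a\<close> and \<open>b\<close>; only then
        are values compared.\<close>
      by (simp add: a_def b_def inj) (simp add: u_def)
  qed
  moreover have "{u 0, u 1, u 2} \<subseteq> profiles_starting_with_one"
    using upd_one_starting_with_one by (auto simp: u_def)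
  moreover have "\<exists>q\<in>{u 0, u 1, u 2}. a q \<noteq> b q" by (auto simp: a_def b_def)
  ultimately show ?thesis unfolding nat_linearly_dependent_def
    by (intro exI[of _ "{u 0, u 1, u 2}"] exI[of _ a] exI[of _ b] conjI) simp_all
qed

theorem theorem3:
  shows "minimal_generating_set profiles_starting_with_one \<and>
         (\<forall>S. minimal_generating_set S \<longrightarrow> S = profiles_starting_with_one) \<and>
         countable profiles_starting_with_one \<and>
         infinite profiles_starting_with_one \<and>
         nat_linearly_dependent profiles_starting_with_one"
proof (intro conjI allI impI)
  show "minimal_generating_set profiles_starting_with_one"
    unfolding minimal_generating_set_def
    using generating_set_starting_with_one generating_set_contains_starting_with_one by blast
  \<comment> \<open>\<open>S\<close> contains the generating set
    \<open>profiles_starting_with_one\<close>, and by minimality the inclusion cannot be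
    proper.\<close>
  show "S = profiles_starting_with_one" if "minimal_generating_set S" for S
    using that generating_set_starting_with_one generating_set_contains_starting_with_one
    unfolding minimal_generating_set_def by blast
  show "countable profiles_starting_with_one"
    using countable_profiles
    by (rule countable_subset[rotated]) (auto simp: profiles_starting_with_one_def)
qed (fact infinite_starting_with_one dependent_starting_with_one)+

end
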